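(* Let $F$ be a field and let $P_1,\dots,P_m$ be any nonconstant monic polynomials over $F$. Then $$\prod_{i=1}^{m}L(P_i)=L(P),$$ where $P(X)\in F[X]$ is the minimal polynomial of the Kronecker product of the companion matrices of $P_1,\dots,P_m$.
   Context: For a monic polynomial $Q(X)=X^d-c_{d-1}X^{d-1}-\cdots-c_0$ over $F$, $L(Q)$ denotes the $F$-vector space of all sequences $(u_k)_{k\ge0}$ in $F$ satisfying the linear recurrence corresponding to $Q$, i.e. $u_{k+d}=c_{d-1}u_{k+d-1}+\cdots+c_0u_k$ for all $k\ge0$. Sequences are multiplied termwise, and the product $\prod_i L(P_i)$ is the $F$-linear span of all termwise products $u^{(1)}\cdots u^{(m)}$ with $u^{(i)}\in L(P_i)$. *)

theory Defs
  imports
    "Jordan_Normal_Form.Matrix"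
    "HOL-Computational_Algebra.Polynomial"
    "HOL-Library.Function_Algebras"
begin

definition seq_scale :: "'a::field \<Rightarrow> (nat \<Rightarrow> 'a) \<Rightarrow> nat \<Rightarrow> 'a" where
  "seq_scale c u = (\<lambda>k. c * u k)"

text \<open>The additive group structure on \<open>nat \<Rightarrow> 'a\<close> is the pointwise one of
  \<open>Function_Algebras\<close>; \<open>seq.span\<close> is the library's linear span.\<close>

interpretation seq: vector_space "seq_scale :: 'a::field \<Rightarrow> (nat \<Rightarrow> 'a) \<Rightarrow> nat \<Rightarrow> 'a"
  by unfold_locales (auto simp: seq_scale_def fun_eq_iff algebra_simps)

text \<open>\<open>L(Q)\<close>, meant for monic \<open>Q\<close>. Writing \<open>Q = X^d - c_(d-1) X^(d-1) - ... - c_0\<close>, we have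
  \<open>c_j = - coeff Q j\<close> for \<open>j < d\<close>.\<close>

definition lin_rec_space :: "'a::field poly \<Rightarrow> (nat \<Rightarrow> 'a) set" where
  "lin_rec_space Q =
     {u. \<forall>k. u (k + degree Q) = (\<Sum>j<degree Q. - coeff Q j * u (k + j))}"

definition seq_space_prod :: "'i set \<Rightarrow> ('i \<Rightarrow> (nat \<Rightarrow> 'a::field) set) \<Rightarrow> (nat \<Rightarrow> 'a) set" where
  "seq_space_prod I S = seq.span {(\<lambda>k. \<Prod>i\<in>I. u i k) | u. \<forall>i\<in>I. u i \<in> S i}"

text \<open>Ones on the subdiagonal, and the recurrence coefficients \<open>c_0, ..., c_(d-1)\<close> in the last
  column.\<close>

definition companion_mat :: "'a::field poly \<Rightarrow> 'a mat" where
  "companion_mat Q = mat (degree Q) (degree Q)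
     (\<lambda>(i, j). if j = degree Q - 1 then - coeff Q i else if i = j + 1 then 1 else 0)"

definition kronecker_mat :: "'a::field mat \<Rightarrow> 'a mat \<Rightarrow> 'a mat" where
  "kronecker_mat A B = mat (dim_row A * dim_row B) (dim_col A * dim_col B)
     (\<lambda>(i, j). A $$ (i div dim_row B, j div dim_col B) * B $$ (i mod dim_row B, j mod dim_col B))"

text \<open>The one-by-one identity matrix is neutral for the Kronecker product.\<close>

definition kronecker_list :: "'a::field mat list \<Rightarrow> 'a mat" where
  "kronecker_list As = foldr kronecker_mat As (1\<^sub>m 1)"

text \<open>\<open>p(A)\<close> for a square matrix \<open>A\<close>; the sum of matrices is written entrywise
  because the type of matrices, of all dimensions at once, is not an additive monoid.\<close>

definition poly_mat :: "'a::field poly \<Rightarrow> 'a mat \<Rightarrow> 'a mat" where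
  "poly_mat p A = mat (dim_row A) (dim_row A)
     (\<lambda>(i, j). \<Sum>k\<le>degree p. coeff p k * (A ^\<^sub>m k) $$ (i, j))"

text \<open>The monic annihilating polynomial of least degree; it exists and is unique for every
  square matrix over a field.\<close>

definition min_poly_mat :: "'a::field mat \<Rightarrow> 'a poly" where
  "min_poly_mat A = (THE p. lead_coeff p = 1 \<and> poly_mat p A = 0\<^sub>m (dim_row A) (dim_row A) \<and>
     (\<forall>q. lead_coeff q = 1 \<longrightarrow> poly_mat q A = 0\<^sub>m (dim_row A) (dim_row A) \<longrightarrow> degree p \<le> degree q))"

end

theory Submission
  imports Defs
begin

text \<open>
  The sequences in \<open>L(Q)\<close> are exactly \<open>k \<mapsto> w C^k e_0\<close>, where \<open>C\<close> is the companion matrix of \<open>Q\<close>,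
  \<open>e_0\<close> the first standard basis vector and \<open>w\<close> an arbitrary row vector: a row of \<open>d\<close>
  consecutive terms of the sequence is advanced one step by multiplication with \<open>C\<close> from the right
  (\<open>lin_rec_space_eq_orbit_space\<close>). For any square matrix \<open>A\<close> let \<open>T(A)\<close>, the \<open>orbit_space\<close>, be the
  space of all sequences \<open>k \<mapsto> w A^k e_0\<close>.

  Let \<open>K\<close> be the Kronecker product of the companion matrices \<open>C_i\<close>. Then \<open>K^k\<close> is the Kronecker
  product of the \<open>C_i^k\<close>, and the first standard basis vector is the tensor product of the \<open>e_0\<close>. As
  every row vector is a linear combination of pure tensors, the span of the termwise products is
  \<open>T(K)\<close> (\<open>seq_space_prod_insert\<close>, one factor at a time).

  What remains is \<open>T(K) = L(P)\<close>, where \<open>P\<close> is the minimal polynomial of \<open>K\<close>. The inclusion of \<open>T(K)\<close>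
  in \<open>L(P)\<close> is just \<open>P(K) = 0\<close>. For the other one, \<open>e_0\<close> must have no annihilating polynomial of
  smaller degree than \<open>P\<close>. The reason is that \<open>e_0\<close> is cyclic for the commutant of \<open>K\<close>
  (\<open>commutant_cyclic\<close>): the matrices \<open>C_1^a_1 \<otimes> ... \<otimes> C_m^a_m\<close> commute with \<open>K\<close> and carry \<open>e_0\<close> to all
  standard basis vectors. So \<open>p(K) e_0 = 0\<close> forces \<open>p(K) = 0\<close>, and the vectors \<open>K^j e_0\<close> with
  \<open>j < deg P\<close> are linearly independent. A row vector \<open>w\<close> can then be chosen so that
  \<open>w K^j e_0\<close> takes any prescribed values for \<open>j < deg P\<close>, which are the initial values that determine
  a member of \<open>L(P)\<close> (\<open>orbit_space_eq_lin_rec_space\<close>).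
\<close>

section \<open>Linear algebra over a field\<close>

lemma sum_fun_apply: "(\<Sum>i\<in>I. f i) x = (\<Sum>i\<in>I. f i x)"
  by (induction I rule: infinite_finite_induct) auto

text \<open>The coordinates \<open>x k i\<close> with \<open>i \<ge> n\<close> are cut off, so that the vectors become sequences in the
  span of \<open>n\<close> unit sequences, where the dimension bound for \<open>seq.span\<close> applies. Two equal vectors
  are treated apart because linear dependence is a property of a set, not of a family.\<close>

lemma exists_linear_relation:
  fixes x :: "nat \<Rightarrow> nat \<Rightarrow> 'a::field"
  shows "\<exists>c. (\<exists>k<Suc n. c k \<noteq> 0) \<and> (\<forall>i<n. (\<Sum>k<Suc n. c k * x k i) = 0)"
proof -
  define y where "y k = (\<lambda>i. if i < n then x k i else 0)" for k
  define e :: "nat \<Rightarrow> nat \<Rightarrow> 'a" where "e i = (\<lambda>l. if l = i then 1 else 0)" for i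
  show ?thesis
  proof (cases "inj_on y {..<Suc n}")
    case False
    then obtain a b where ab: "a < Suc n" "b < Suc n" "a \<noteq> b" "y a = y b"
      by (auto simp: inj_on_def)
    let ?c = "\<lambda>k. if k = a then 1 else if k = b then -1 else (0::'a)"
    have "(\<Sum>k<Suc n. ?c k * x k i) = 0" if "i < n" for i
    proof -
      have "x a i = x b i"
        using fun_cong[OF ab(4), of i] that by (simp add: y_def)
      moreover have "(\<Sum>k<Suc n. ?c k * x k i) = (\<Sum>k\<in>{a, b}. ?c k * x k i)"
        using ab by (intro sum.mono_neutral_right) auto
      ultimately show ?thesis using ab by simp
    qed
    moreover have "?c a \<noteq> 0" by simp
    ultimately show ?thesis using ab(1) by (intro exI[of _ ?c]) blast
  next
    case True
    have span: "y ` {..<Suc n} \<subseteq> seq.span (e ` {..<n})"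
    proof
      fix v assume "v \<in> y ` {..<Suc n}"
      then obtain k where v: "v = y k" by auto
      have "y k = (\<Sum>i<n. seq_scale (x k i) (e i))"
        by (rule ext) (simp add: y_def e_def seq_scale_def sum_fun_apply if_distrib cong: if_cong)
      then show "v \<in> seq.span (e ` {..<n})"
        unfolding v by (auto intro: seq.span_sum seq.span_scale seq.span_base)
    qed
    have "card (e ` {..<n}) \<le> n" using card_image_le[of "{..<n}" e] by simp
    then have "seq.dependent (y ` {..<Suc n})"
      using seq.independent_span_bound[OF _ _ span] card_image[OF True] by force
    then obtain g where g: "\<exists>v\<in>y ` {..<Suc n}. g v \<noteq> 0"
        "(\<Sum>v\<in>y ` {..<Suc n}. seq_scale (g v) v) = 0"
      by (subst (asm) seq.dependent_finite) auto
    have "(\<Sum>k<Suc n. seq_scale (g (y k)) (y k)) = 0"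
      using g(2) by (subst (asm) sum.reindex[OF True]) (simp add: o_def)
    then have "(\<Sum>k<Suc n. seq_scale (g (y k)) (y k)) i = 0" for i
      by (simp only: zero_fun_apply)
    then have "(\<Sum>k<Suc n. g (y k) * y k i) = 0" for i
      by (simp only: sum_fun_apply seq_scale_def)
    moreover have "(\<Sum>k<Suc n. g (y k) * y k i) = (\<Sum>k<Suc n. g (y k) * x k i)" if "i < n" for i
      by (intro sum.cong refl arg_cong2[where f = "(*)"]) (simp add: y_def that)
    ultimately have "\<forall>i<n. (\<Sum>k<Suc n. g (y k) * x k i) = 0" by simp
    moreover have "\<exists>k<Suc n. g (y k) \<noteq> 0" using g(1) by blast
    ultimately show ?thesis by (intro exI[of _ "\<lambda>k. g (y k)"] conjI)
  qed
qed

text \<open>The induction adds the vector \<open>x d\<close> to \<open>d\<close> vectors for which the claim holds. It suffices that some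
  functional \<open>v\<close> kills the old vectors but not \<open>x d\<close>, as a multiple of \<open>v\<close> then corrects the value
  at \<open>x d\<close>. If there were none, subtracting from each coordinate functional its combination of
  dual functionals \<open>w l\<close> would express \<open>x d\<close> by the old vectors.\<close>

lemma functional_with_prescribed_values:
  fixes x :: "nat \<Rightarrow> nat \<Rightarrow> 'a::field"
  assumes "\<And>c j. (\<And>i. i < n \<Longrightarrow> (\<Sum>j<d. c j * x j i) = 0) \<Longrightarrow> j < d \<Longrightarrow> c j = 0"
  shows "\<exists>w. \<forall>j<d. (\<Sum>i<n. w i * x j i) = u j"
  using assms
proof (induction d arbitrary: u)
  case 0
  then show ?case by simp
next
  case (Suc d)
  have indep: "c j = 0" if "\<And>i. i < n \<Longrightarrow> (\<Sum>j<d. c j * x j i) = 0" "j < d" for c j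
    using Suc.prems[of "c(d := 0)" j] that by simp
  have IH: "\<exists>w. \<forall>j<d. (\<Sum>i<n. w i * x j i) = u j" for u :: "nat \<Rightarrow> 'a"
    by (rule Suc.IH) (use indep in blast)
  have "\<exists>v. (\<forall>j<d. (\<Sum>i<n. v i * x j i) = 0) \<and> (\<Sum>i<n. v i * x d i) \<noteq> 0"
  proof (rule ccontr)
    assume "\<not> ?thesis"
    then have kill: "(\<Sum>i<n. v i * x d i) = 0" if "\<And>j. j < d \<Longrightarrow> (\<Sum>i<n. v i * x j i) = 0" for v
      using that by blast
    have "\<forall>l. \<exists>w. \<forall>j<d. (\<Sum>i<n. w i * x j i) = (if j = l then 1 else 0)"
      using IH[of "\<lambda>j. if j = _ then 1 else 0"] by blast
    then obtain w where w: "\<And>l j. j < d \<Longrightarrow> (\<Sum>i<n. w l i * x j i) = (if j = l then 1 else 0)"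
      by metis
    define b where "b l = (\<Sum>i<n. w l i * x d i)" for l
    have expand: "(\<Sum>i<n. ((if i = a then 1 else 0) - (\<Sum>l<d. x l a * w l i)) * x j i)
        = x j a - (\<Sum>l<d. x l a * (\<Sum>i<n. w l i * x j i))" if "a < n" for a j
    proof -
      have "(\<Sum>i<n. (\<Sum>l<d. x l a * w l i) * x j i) = (\<Sum>l<d. x l a * (\<Sum>i<n. w l i * x j i))"
        by (simp add: sum_distrib_right sum_distrib_left mult.assoc) (rule sum.swap)
      then show ?thesis using that
        by (simp add: left_diff_distrib sum_subtractf if_distrib[of "\<lambda>t. t * _"] cong: if_cong)
    qed
    have rel: "x d a = (\<Sum>l<d. b l * x l a)" if a: "a < n" for a
    proof -
      \<comment> \<open>the functional that reads coordinate \<open>a\<close>, modified to vanish at the vectors before \<open>x d\<close>\<close>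
      let ?v = "\<lambda>i. (if i = a then 1 else 0) - (\<Sum>l<d. x l a * w l i)"
      have "x j a - (\<Sum>l<d. x l a * (\<Sum>i<n. w l i * x j i)) = 0" if "j < d" for j
        by (simp add: w[OF that] that if_distrib cong: if_cong)
      then have "(\<Sum>i<n. ?v i * x j i) = 0" if "j < d" for j
        using that by (simp only: expand[OF a])
      then have "(\<Sum>i<n. ?v i * x d i) = 0" by (rule kill)
      then have "x d a - (\<Sum>l<d. x l a * (\<Sum>i<n. w l i * x d i)) = 0"
        by (simp only: expand[OF a])
      then show ?thesis by (simp add: b_def mult.commute)
    qed
    \<comment> \<open>the relation \<open>rel\<close>, with coefficient \<open>-1\<close> at \<open>x d\<close>, contradicts independence\<close>
    have "(b(d := -1)) d = 0"
      by (rule Suc.prems) (simp_all add: rel)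
    then show False by simp
  qed
  then obtain v where v: "\<And>j. j < d \<Longrightarrow> (\<Sum>i<n. v i * x j i) = 0" "(\<Sum>i<n. v i * x d i) \<noteq> 0"
    by blast
  obtain w where w: "\<And>j. j < d \<Longrightarrow> (\<Sum>i<n. w i * x j i) = u j" using IH by blast
  define t where "t = (u d - (\<Sum>i<n. w i * x d i)) / (\<Sum>i<n. v i * x d i)"
  have "(\<Sum>i<n. (w i + t * v i) * x j i) = (\<Sum>i<n. w i * x j i) + t * (\<Sum>i<n. v i * x j i)" for j
    by (simp add: algebra_simps sum.distrib sum_distrib_left)
  then have "\<forall>j<Suc d. (\<Sum>i<n. (w i + t * v i) * x j i) = u j"
    using v w by (auto simp: less_Suc_eq t_def)
  then show ?case by (rule exI[of _ "\<lambda>i. w i + t * v i"])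
qed

section \<open>Linear recurrences\<close>

lemma lin_rec_space_monic:
  assumes "lead_coeff Q = 1"
  shows "u \<in> lin_rec_space Q \<longleftrightarrow> (\<forall>k. (\<Sum>j\<le>degree Q. coeff Q j * u (k + j)) = 0)"
proof -
  have "(\<Sum>j\<le>degree Q. coeff Q j * u (k + j))
      = u (k + degree Q) - (\<Sum>j<degree Q. - coeff Q j * u (k + j))" for k
    using assms by (simp flip: lessThan_Suc_atMost add: sum_negf)
  then show ?thesis by (simp add: lin_rec_space_def)
qed

lemma lin_rec_space_eqI:
  assumes "u \<in> lin_rec_space Q" "v \<in> lin_rec_space Q" "\<And>k. k < degree Q \<Longrightarrow> u k = v k"
  shows "u = v"
proof
  fix k show "u k = v k"
  proof (induction k rule: less_induct)
    case (less k)
    show ?case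
    proof (cases "k < degree Q")
      case False
      define l where "l = k - degree Q"
      have k: "k = l + degree Q" using False by (simp add: l_def)
      have "(\<Sum>j<degree Q. - coeff Q j * u (l + j)) = (\<Sum>j<degree Q. - coeff Q j * v (l + j))"
        by (intro sum.cong) (simp_all add: less k)
      then show ?thesis using assms(1,2) by (simp add: lin_rec_space_def k)
    qed (use assms in simp)
  qed
qed

section \<open>Matrix entries\<close>

lemma mult_mat_entry:
  assumes "A \<in> carrier_mat n m" "B \<in> carrier_mat m p" "i < n" "j < p"
  shows "(A * B) $$ (i, j) = (\<Sum>l<m. A $$ (i, l) * B $$ (l, j))"
  using assms by (simp add: scalar_prod_def lessThan_atLeast0)

lemma pow_mat_add:
  fixes A :: "'a::semiring_1 mat"
  assumes "A \<in> carrier_mat n n"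
  shows "A ^\<^sub>m (k + l) = A ^\<^sub>m k * A ^\<^sub>m l"
proof (induction l)
  case (Suc l)
  then show ?case
    using assms assoc_mult_mat[of "A ^\<^sub>m k" n n "A ^\<^sub>m l" n A n] by simp
qed (use assms in simp)

lemma pow_mat_commute:
  fixes A :: "'a::semiring_1 mat"
  assumes A: "A \<in> carrier_mat n n" and B: "B \<in> carrier_mat n n" and AB: "A * B = B * A"
  shows "A ^\<^sub>m k * B = B * A ^\<^sub>m k"
proof (induction k)
  case (Suc k)
  have P: "A ^\<^sub>m k \<in> carrier_mat n n" using A by simp
  have "A ^\<^sub>m Suc k * B = A ^\<^sub>m k * (A * B)"
    using assoc_mult_mat[OF P A B] by simp
  also have "\<dots> = A ^\<^sub>m k * B * A" using assoc_mult_mat[OF P B A] AB by simp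
  also have "\<dots> = B * A ^\<^sub>m Suc k" using assoc_mult_mat[OF B P A] Suc by simp
  finally show ?case .
qed (use A B in simp)

text \<open>The bound \<open>d\<close> is kept apart from the degree so that sums for different polynomials can be
  compared term by term.\<close>

lemma poly_mat_eq_0_iff:
  assumes "A \<in> carrier_mat n n" "degree p < d"
  shows "poly_mat p A = 0\<^sub>m n n \<longleftrightarrow>
    (\<forall>i<n. \<forall>j<n. (\<Sum>k<d. coeff p k * (A ^\<^sub>m k) $$ (i, j)) = 0)"
proof -
  have "(\<Sum>k\<le>degree p. coeff p k * (A ^\<^sub>m k) $$ (i, j)) = (\<Sum>k<d. coeff p k * (A ^\<^sub>m k) $$ (i, j))"
    for i j
    using assms(2) by (intro sum.mono_neutral_left) (auto simp: coeff_eq_0)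
  then show ?thesis
    using assms(1) by (auto simp: poly_mat_def mat_eq_iff)
qed

lemma monic_annihilator:
  assumes A: "A \<in> carrier_mat n n" and p: "poly_mat p A = 0\<^sub>m n n" "p \<noteq> 0"
  shows "\<exists>q. lead_coeff q = 1 \<and> degree q = degree p \<and> poly_mat q A = 0\<^sub>m n n"
proof (intro exI conjI)
  let ?q = "smult (inverse (lead_coeff p)) p"
  show "lead_coeff ?q = 1" "degree ?q = degree p" using p by auto
  have "(\<Sum>k<Suc (degree p). coeff ?q k * (A ^\<^sub>m k) $$ (i, j))
      = inverse (lead_coeff p) * (\<Sum>k<Suc (degree p). coeff p k * (A ^\<^sub>m k) $$ (i, j))" for i j
    by (simp only: sum_distrib_left coeff_smult mult.assoc)
  then show "poly_mat ?q A = 0\<^sub>m n n"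
    using p by (simp add: poly_mat_eq_0_iff[OF A, where d = "Suc (degree p)"] del: sum.lessThan_Suc)
qed

text \<open>Uniqueness, which the definite description needs: the difference of two monic annihilating
  polynomials of the same least degree annihilates and has smaller degree, so it is zero.\<close>

lemma min_poly_mat_minimal:
  assumes A: "A \<in> carrier_mat n n" and ex: "lead_coeff p0 = 1" "poly_mat p0 A = 0\<^sub>m n n"
  shows "lead_coeff (min_poly_mat A) = 1"
    and "poly_mat (min_poly_mat A) A = 0\<^sub>m n n"
    and "\<And>q. lead_coeff q = 1 \<Longrightarrow> poly_mat q A = 0\<^sub>m n n \<Longrightarrow> degree (min_poly_mat A) \<le> degree q"
proof -
  let ?ann = "\<lambda>p. lead_coeff p = 1 \<and> poly_mat p A = 0\<^sub>m n n"
  let ?min = "\<lambda>p. lead_coeff p = 1 \<and> poly_mat p A = 0\<^sub>m n n \<and>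
    (\<forall>q. lead_coeff q = 1 \<longrightarrow> poly_mat q A = 0\<^sub>m n n \<longrightarrow> degree p \<le> degree q)"
  have "\<exists>p. ?ann p \<and> (\<forall>q. ?ann q \<longrightarrow> degree p \<le> degree q)"
    by (rule ex_has_least_nat[of ?ann p0]) (use ex in simp)
  then obtain p where p: "?min p" by blast
  have "q = p" if q: "?min q" for q
  proof (rule ccontr)
    assume "q \<noteq> p"
    then have r: "q - p \<noteq> 0" by simp
    have deg: "degree q = degree p" using p q by (meson le_antisym)
    then have "coeff (q - p) (degree p) = 0" using p q by simp
    moreover have "degree (q - p) \<le> degree p" using degree_diff_le_max[of q p] deg by simp
    ultimately have less: "degree (q - p) < degree p"
      using r by (metis leading_coeff_0_iff le_neq_implies_less)
    have "(\<Sum>k<Suc (degree p). coeff (q - p) k * (A ^\<^sub>m k) $$ (i, j))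
        = (\<Sum>k<Suc (degree p). coeff q k * (A ^\<^sub>m k) $$ (i, j))
          - (\<Sum>k<Suc (degree p). coeff p k * (A ^\<^sub>m k) $$ (i, j))" for i j
      by (simp only: coeff_diff left_diff_distrib sum_subtractf)
    then have "poly_mat (q - p) A = 0\<^sub>m n n"
      using p q less deg
      by (simp add: poly_mat_eq_0_iff[OF A, where d = "Suc (degree p)"] del: sum.lessThan_Suc)
    then show False using monic_annihilator[OF A _ r] less p by fastforce
  qed
  then have "?min (min_poly_mat A)"
    using theI[of ?min, OF p] A by (simp add: min_poly_mat_def)
  then show "lead_coeff (min_poly_mat A) = 1" "poly_mat (min_poly_mat A) A = 0\<^sub>m n n"
    "\<And>q. lead_coeff q = 1 \<Longrightarrow> poly_mat q A = 0\<^sub>m n n \<Longrightarrow> degree (min_poly_mat A) \<le> degree q"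
    by blast+
qed

section \<open>The sequences of a cyclic vector\<close>

text \<open>These are the sequences \<open>k \<mapsto> w A^k e_0\<close>, where \<open>e_0\<close> is the first standard basis vector, so that
  \<open>A^k e_0\<close> is the first column of \<open>A^k\<close>.\<close>

definition orbit_space :: "'a::field mat \<Rightarrow> (nat \<Rightarrow> 'a) set" where
  "orbit_space A = {\<lambda>k. \<Sum>i<dim_row A. w i * (A ^\<^sub>m k) $$ (i, 0) | w. True}"

text \<open>The vector \<open>e_0\<close> generates the whole space under the matrices commuting with \<open>A\<close>. This is weaker
  than being cyclic for \<open>A\<close> itself, which Kronecker products do not inherit.\<close>

definition commutant_cyclic :: "nat \<Rightarrow> 'a::field mat \<Rightarrow> bool" where
  "commutant_cyclic n A \<longleftrightarrow> A \<in> carrier_mat n n \<and> 0 < n \<and>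
    (\<forall>j<n. \<exists>B\<in>carrier_mat n n. A * B = B * A \<and> (\<forall>i<n. B $$ (i, 0) = (if i = j then 1 else 0)))"

text \<open>If \<open>B\<close> commutes with \<open>A\<close> and \<open>B e_0 = e_j\<close>, then \<open>p(A) e_j = p(A) B e_0 = B p(A) e_0\<close>; so a
  polynomial that annihilates \<open>e_0\<close> annihilates every basis vector.\<close>

lemma poly_mat_eq_0_if_first_column:
  assumes cyc: "commutant_cyclic n A" and "degree p < d"
    and col: "\<And>i. i < n \<Longrightarrow> (\<Sum>k<d. coeff p k * (A ^\<^sub>m k) $$ (i, 0)) = 0"
  shows "poly_mat p A = 0\<^sub>m n n"
proof -
  have A: "A \<in> carrier_mat n n" and n: "0 < n" using cyc by (auto simp: commutant_cyclic_def)
  have "(\<Sum>k<d. coeff p k * (A ^\<^sub>m k) $$ (i, j)) = 0" if i: "i < n" and j: "j < n" for i j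
  proof -
    obtain B where B: "B \<in> carrier_mat n n" "A * B = B * A"
        "\<And>i. i < n \<Longrightarrow> B $$ (i, 0) = (if i = j then 1 else 0)"
      using cyc j by (auto simp: commutant_cyclic_def)
    have "(A ^\<^sub>m k) $$ (i, j) = (\<Sum>l<n. B $$ (i, l) * (A ^\<^sub>m k) $$ (l, 0))" for k
    proof -
      have P: "A ^\<^sub>m k \<in> carrier_mat n n" using A by simp
      have "(A ^\<^sub>m k * B) $$ (i, 0) = (A ^\<^sub>m k) $$ (i, j)"
        using j by (simp add: mult_mat_entry[OF P B(1) i n] B(3) if_distrib cong: if_cong)
      then show ?thesis
        using mult_mat_entry[OF B(1) P i n] pow_mat_commute[OF A B(1,2)] by simp
    qed
    then have "(\<Sum>k<d. coeff p k * (A ^\<^sub>m k) $$ (i, j))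
        = (\<Sum>l<n. B $$ (i, l) * (\<Sum>k<d. coeff p k * (A ^\<^sub>m k) $$ (l, 0)))"
      by (simp add: sum_distrib_left mult.left_commute) (rule sum.swap)
    then show ?thesis by (simp add: col)
  qed
  then show ?thesis using poly_mat_eq_0_iff[OF A assms(2)] by blast
qed

text \<open>Serves twice: among \<open>n + 1\<close> columns there is always a relation, whence a minimal polynomial
  exists; and no relation can hold among fewer columns than the degree of the minimal polynomial.\<close>

lemma monic_annihilator_of_column_relation:
  assumes cyc: "commutant_cyclic n A" and c: "k0 < d" "c k0 \<noteq> 0"
    and col: "\<And>i. i < n \<Longrightarrow> (\<Sum>k<d. c k * (A ^\<^sub>m k) $$ (i, 0)) = 0"
  shows "\<exists>p. lead_coeff p = 1 \<and> degree p < d \<and> poly_mat p A = 0\<^sub>m n n"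
proof -
  define p where "p = (\<Sum>k<d. monom (c k) k)"
  have coeff: "coeff p k = (if k < d then c k else 0)" for k
    by (simp add: p_def coeff_sum if_distrib cong: if_cong)
  have "p \<noteq> 0" using coeff[of k0] c by auto
  then have deg: "degree p < d" using coeff by (metis leading_coeff_0_iff)
  have "poly_mat p A = 0\<^sub>m n n"
    by (rule poly_mat_eq_0_if_first_column[OF cyc deg]) (simp add: coeff col)
  then show ?thesis
    using monic_annihilator[OF _ _ \<open>p \<noteq> 0\<close>] cyc deg by (metis commutant_cyclic_def)
qed

text \<open>The inclusion from left to right holds because the minimal polynomial annihilates \<open>A\<close>. For the
  converse, the columns \<open>A^j e_0\<close> below its degree are independent by minimality, so some \<open>w\<close> matches
  the initial values of a given solution, and two solutions with equal initial values agree.\<close>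

lemma orbit_space_eq_lin_rec_space:
  assumes cyc: "commutant_cyclic n A"
  shows "orbit_space A = lin_rec_space (min_poly_mat A)"
proof -
  have A: "A \<in> carrier_mat n n" and n: "0 < n" using cyc by (auto simp: commutant_cyclic_def)
  obtain p0 where p0: "lead_coeff p0 = 1" "poly_mat p0 A = 0\<^sub>m n n"
  proof -
    obtain c k where c: "k < Suc n" "c k \<noteq> 0"
        "\<And>i. i < n \<Longrightarrow> (\<Sum>k<Suc n. c k * (A ^\<^sub>m k) $$ (i, 0)) = 0"
      using exists_linear_relation[of n "\<lambda>k i. (A ^\<^sub>m k) $$ (i, 0)"] by blast
    show thesis using monic_annihilator_of_column_relation[OF cyc c] that by blast
  qed
  define P where "P = min_poly_mat A"
  note P = min_poly_mat_minimal[OF A p0, folded P_def]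
  have sub: "orbit_space A \<subseteq> lin_rec_space P"
  proof
    fix u assume "u \<in> orbit_space A"
    then obtain w where u: "u = (\<lambda>k. \<Sum>i<n. w i * (A ^\<^sub>m k) $$ (i, 0))"
      using A by (auto simp: orbit_space_def)
    have "(\<Sum>j\<le>degree P. coeff P j * (A ^\<^sub>m (k + j)) $$ (i, 0)) = 0" if i: "i < n" for i k
    proof -
      have "(A ^\<^sub>m (k + j)) $$ (i, 0) = (\<Sum>l<n. (A ^\<^sub>m k) $$ (i, l) * (A ^\<^sub>m j) $$ (l, 0))" for j
        using mult_mat_entry[OF pow_carrier_mat[OF A] pow_carrier_mat[OF A] i n]
        by (simp add: pow_mat_add[OF A])
      then have "(\<Sum>j\<le>degree P. coeff P j * (A ^\<^sub>m (k + j)) $$ (i, 0))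
          = (\<Sum>l<n. (A ^\<^sub>m k) $$ (i, l) * (\<Sum>j\<le>degree P. coeff P j * (A ^\<^sub>m j) $$ (l, 0)))"
        by (simp add: sum_distrib_left mult.left_commute) (rule sum.swap)
      also have "\<dots> = 0"
        using P(2) n by (simp add: poly_mat_eq_0_iff[OF A lessI] lessThan_Suc_atMost)
      finally show ?thesis .
    qed
    moreover have "(\<Sum>j\<le>degree P. coeff P j * u (k + j))
        = (\<Sum>i<n. w i * (\<Sum>j\<le>degree P. coeff P j * (A ^\<^sub>m (k + j)) $$ (i, 0)))" for k
      by (simp add: u sum_distrib_left mult.left_commute) (rule sum.swap)
    ultimately show "u \<in> lin_rec_space P" by (simp add: lin_rec_space_monic[OF P(1)])
  qed
  have "lin_rec_space P \<subseteq> orbit_space A"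
  proof
    fix u assume u: "u \<in> lin_rec_space P"
    have indep: "c j = 0"
      if rel: "\<And>i. i < n \<Longrightarrow> (\<Sum>j<degree P. c j * (A ^\<^sub>m j) $$ (i, 0)) = 0"
        and j: "j < degree P" for c j
    proof (rule ccontr)
      assume "c j \<noteq> 0"
      then obtain q where "lead_coeff q = 1" "degree q < degree P" "poly_mat q A = 0\<^sub>m n n"
        using monic_annihilator_of_column_relation[OF cyc j _ rel] by blast
      then show False using P(3) by fastforce
    qed
    have "\<exists>w. \<forall>j<degree P. (\<Sum>i<n. w i * (A ^\<^sub>m j) $$ (i, 0)) = u j"
      by (rule functional_with_prescribed_values) (use indep in blast)
    then obtain w where w: "\<And>j. j < degree P \<Longrightarrow> (\<Sum>i<n. w i * (A ^\<^sub>m j) $$ (i, 0)) = u j"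
      by blast
    let ?v = "\<lambda>k. \<Sum>i<n. w i * (A ^\<^sub>m k) $$ (i, 0)"
    have v: "?v \<in> orbit_space A" using A by (auto simp: orbit_space_def)
    have "u = ?v" by (rule lin_rec_space_eqI[OF u]) (use v sub w in auto)
    then show "u \<in> orbit_space A" using v by simp
  qed
  with sub show ?thesis by (simp add: P_def)
qed

section \<open>Companion matrices\<close>

lemma companion_mat_carrier [simp]: "companion_mat Q \<in> carrier_mat (degree Q) (degree Q)"
  by (simp add: companion_mat_def)

text \<open>The companion matrix shifts the standard basis, \<open>C e_k = e_(k+1)\<close>, as long as \<open>k + 1\<close> stays below
  the degree.\<close>

lemma companion_mat_pow_first_column:
  assumes "k < degree Q" "i < degree Q"
  shows "(companion_mat Q ^\<^sub>m k) $$ (i, 0) = (if i = k then 1 else 0)"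
  using assms
proof (induction k arbitrary: i)
  case 0
  then show ?case by (simp add: companion_mat_def)
next
  case (Suc k)
  let ?C = "companion_mat Q"
  have d: "0 < degree Q" using Suc.prems(1) by simp
  have "?C ^\<^sub>m Suc k = ?C * ?C ^\<^sub>m k"
    using pow_mat_commute[OF companion_mat_carrier companion_mat_carrier refl, of Q] by simp
  then have "(?C ^\<^sub>m Suc k) $$ (i, 0) = (\<Sum>l<degree Q. ?C $$ (i, l) * (?C ^\<^sub>m k) $$ (l, 0))"
    using mult_mat_entry[OF companion_mat_carrier pow_carrier_mat[OF companion_mat_carrier] Suc.prems(2) d]
    by simp
  also have "\<dots> = ?C $$ (i, k)"
    using Suc.prems by (simp add: Suc.IH if_distrib cong: if_cong)
  finally show ?case using Suc.prems by (auto simp: companion_mat_def)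
qed

lemma commutant_cyclic_companion_mat:
  assumes "degree Q > 0"
  shows "commutant_cyclic (degree Q) (companion_mat Q)"
  unfolding commutant_cyclic_def
proof (intro conjI allI impI)
  fix j assume j: "j < degree Q"
  have "companion_mat Q * companion_mat Q ^\<^sub>m j = companion_mat Q ^\<^sub>m j * companion_mat Q"
    using pow_mat_commute[OF companion_mat_carrier companion_mat_carrier refl, of Q] by simp
  then show "\<exists>B\<in>carrier_mat (degree Q) (degree Q).
      companion_mat Q * B = B * companion_mat Q \<and>
      (\<forall>i<degree Q. B $$ (i, 0) = (if i = j then 1 else 0))"
    using j by (intro bexI[of _ "companion_mat Q ^\<^sub>m j"])
      (simp_all add: companion_mat_pow_first_column pow_carrier_mat)
qed (use assms in simp_all)

text \<open>A solution \<open>u\<close> is obtained from \<open>w = (u_0, ..., u_(d-1))\<close>, because \<open>w C^k\<close> is the window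
  \<open>(u_k, ..., u_(k+d-1))\<close>. Conversely, \<open>C^(k+j) e_0 = C^k e_j\<close> for \<open>j < d\<close>, and
  \<open>C^(k+d) e_0 = C^k (C e_(d-1))\<close> is the combination of these given by the last column of \<open>C\<close>.\<close>

lemma lin_rec_space_eq_orbit_space:
  assumes d: "degree Q > 0"
  shows "lin_rec_space Q = orbit_space (companion_mat Q)"
proof
  let ?C = "companion_mat Q"
  have dim: "dim_row ?C = degree Q" by (simp add: companion_mat_def)
  have entry: "(?C ^\<^sub>m (k + l)) $$ (i, j) = (\<Sum>r<degree Q. (?C ^\<^sub>m k) $$ (i, r) * (?C ^\<^sub>m l) $$ (r, j))"
    if "i < degree Q" "j < degree Q" for i j k l
    using mult_mat_entry[OF pow_carrier_mat[OF companion_mat_carrier]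
        pow_carrier_mat[OF companion_mat_carrier] that]
    by (simp add: pow_mat_add[OF companion_mat_carrier])
  show "lin_rec_space Q \<subseteq> orbit_space ?C"
  proof
    fix u assume u: "u \<in> lin_rec_space Q"
    have shifted: "u (k + j) = (\<Sum>i<degree Q. u i * (?C ^\<^sub>m k) $$ (i, j))" if "j < degree Q" for k j
      using that
    proof (induction k arbitrary: j)
      case 0
      then show ?case by (simp add: dim if_distrib cong: if_cong)
    next
      case (Suc k)
      have "(\<Sum>i<degree Q. u i * (?C ^\<^sub>m Suc k) $$ (i, j))
          = (\<Sum>i<degree Q. u i * (\<Sum>r<degree Q. (?C ^\<^sub>m k) $$ (i, r) * ?C $$ (r, j)))"
        using entry[OF _ Suc.prems, of _ k 1] by (simp add: dim)
      also have "\<dots> = (\<Sum>r<degree Q. (\<Sum>i<degree Q. u i * (?C ^\<^sub>m k) $$ (i, r)) * ?C $$ (r, j))"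
        by (simp add: sum_distrib_left sum_distrib_right mult.assoc) (rule sum.swap)
      also have "\<dots> = (\<Sum>r<degree Q. u (k + r) * ?C $$ (r, j))"
        by (simp add: Suc.IH)
      also have "\<dots> = u (Suc k + j)"
      proof (cases "j = degree Q - 1")
        case True
        then have "(\<Sum>r<degree Q. u (k + r) * ?C $$ (r, j)) = (\<Sum>r<degree Q. - coeff Q r * u (k + r))"
          using d by (intro sum.cong) (auto simp: companion_mat_def)
        also have "\<dots> = u (k + degree Q)" using u by (simp add: lin_rec_space_def)
        finally show ?thesis using True d by simp
      next
        case False
        then have "(\<Sum>r<degree Q. u (k + r) * ?C $$ (r, j))
            = (\<Sum>r<degree Q. if r = Suc j then u (k + r) else 0)"
          using Suc.prems by (intro sum.cong) (auto simp: companion_mat_def)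
        then show ?thesis using False Suc.prems by simp
      qed
      finally show ?case by simp
    qed
    have "u k = (\<Sum>i<degree Q. u i * (?C ^\<^sub>m k) $$ (i, 0))" for k
      using shifted[OF d, of k] unfolding add_0_right .
    then have "u = (\<lambda>k. \<Sum>i<degree Q. u i * (?C ^\<^sub>m k) $$ (i, 0))" by (rule ext)
    then show "u \<in> orbit_space ?C" unfolding orbit_space_def dim by blast
  qed
  show "orbit_space ?C \<subseteq> lin_rec_space Q"
  proof
    fix u assume "u \<in> orbit_space ?C"
    then obtain w where u: "u = (\<lambda>k. \<Sum>i<degree Q. w i * (?C ^\<^sub>m k) $$ (i, 0))"
      by (auto simp: orbit_space_def dim)
    have col: "(?C ^\<^sub>m (k + j)) $$ (i, 0) = (?C ^\<^sub>m k) $$ (i, j)"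
      if "i < degree Q" "j < degree Q" for i j k
      using that entry[OF that(1) d, of k j]
      by (simp add: companion_mat_pow_first_column if_distrib cong: if_cong)
    have last_col: "?C $$ (r, degree Q - 1) = - coeff Q r" if "r < degree Q" for r
      using d that by (simp add: companion_mat_def)
    have "(?C ^\<^sub>m (k + degree Q)) $$ (i, 0) = (\<Sum>j<degree Q. - coeff Q j * (?C ^\<^sub>m (k + j)) $$ (i, 0))"
      if i: "i < degree Q" for i k
    proof -
      have "k + degree Q = Suc k + (degree Q - 1)" using d by simp
      then have "(?C ^\<^sub>m (k + degree Q)) $$ (i, 0) = (?C ^\<^sub>m Suc k) $$ (i, degree Q - 1)"
        using col[OF i, of "degree Q - 1" "Suc k"] d by simp
      also have "\<dots> = (\<Sum>r<degree Q. (?C ^\<^sub>m k) $$ (i, r) * ?C $$ (r, degree Q - 1))"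
        using entry[OF i, of "degree Q - 1" k 1] d by (simp add: dim)
      also have "\<dots> = (\<Sum>j<degree Q. - coeff Q j * (?C ^\<^sub>m (k + j)) $$ (i, 0))"
        using i by (intro sum.cong) (simp_all only: last_col col lessThan_iff mult.commute)
      finally show ?thesis .
    qed
    then have "u (k + degree Q)
        = (\<Sum>i<degree Q. w i * (\<Sum>j<degree Q. - coeff Q j * (?C ^\<^sub>m (k + j)) $$ (i, 0)))" for k
      unfolding u by (intro sum.cong) simp_all
    also have "(\<Sum>i<degree Q. w i * (\<Sum>j<degree Q. - coeff Q j * (?C ^\<^sub>m (k + j)) $$ (i, 0)))
        = (\<Sum>j<degree Q. \<Sum>i<degree Q. w i * (- coeff Q j * (?C ^\<^sub>m (k + j)) $$ (i, 0)))" for k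
      unfolding sum_distrib_left by (rule sum.swap)
    also have "(\<Sum>j<degree Q. \<Sum>i<degree Q. w i * (- coeff Q j * (?C ^\<^sub>m (k + j)) $$ (i, 0)))
        = (\<Sum>j<degree Q. - coeff Q j * u (k + j))" for k
      unfolding u sum_distrib_left by (simp only: mult.left_commute)
    finally have "u (k + degree Q) = (\<Sum>j<degree Q. - coeff Q j * u (k + j))" for k .
    then show "u \<in> lin_rec_space Q" by (simp add: lin_rec_space_def)
  qed
qed

section \<open>Kronecker products\<close>

text \<open>An index of a Kronecker product stands for the pair of its quotient and remainder.\<close>

lemma sum_lessThan_mult:
  fixes f :: "nat \<Rightarrow> 'a::comm_monoid_add"
  shows "(\<Sum>i<n * p. f i) = (\<Sum>a<n. \<Sum>b<p. f (a * p + b))"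
proof -
  have "sum f {a * p..<a * p + p} = (\<Sum>b<p. f (a * p + b))" for a
    using sum.shift_bounds_nat_ivl[of f 0 "a * p" p]
    by (simp add: lessThan_atLeast0 add.commute)
  then show ?thesis using sum.nat_group[of f p n] by simp
qed

lemma kronecker_mat_carrier:
  assumes "A \<in> carrier_mat n n'" "B \<in> carrier_mat p p'"
  shows "kronecker_mat A B \<in> carrier_mat (n * p) (n' * p')"
  using assms by (simp add: kronecker_mat_def)

lemma kronecker_mat_entry:
  assumes "A \<in> carrier_mat n n'" "B \<in> carrier_mat p p'" "i < n * p" "j < n' * p'"
  shows "kronecker_mat A B $$ (i, j) = A $$ (i div p, j div p') * B $$ (i mod p, j mod p')"
  using assms by (simp add: kronecker_mat_def)

lemma kronecker_mat_mult:
  assumes A: "A \<in> carrier_mat n n" and B: "B \<in> carrier_mat p p"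
    and C: "C \<in> carrier_mat n n" and D: "D \<in> carrier_mat p p"
  shows "kronecker_mat A B * kronecker_mat C D = kronecker_mat (A * C) (B * D)"
proof (rule eq_matI)
  note K = kronecker_mat_carrier[OF A B] kronecker_mat_carrier[OF C D]
  have AC: "A * C \<in> carrier_mat n n" and BD: "B * D \<in> carrier_mat p p" using A B C D by auto
  fix i j
  assume "i < dim_row (kronecker_mat (A * C) (B * D))" "j < dim_col (kronecker_mat (A * C) (B * D))"
  then have i: "i < n * p" and j: "j < n * p"
    using kronecker_mat_carrier[OF AC BD] by auto
  have p: "0 < p" using i by (cases p) auto
  have bounds: "i div p < n" "j div p < n" "i mod p < p" "j mod p < p"
    using i j p by (auto simp: less_mult_imp_div_less)
  have lt: "a * p + b < n * p" if "a < n" "b < p" for a b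
  proof -
    have "a * p + b < Suc a * p" using that by simp
    also have "\<dots> \<le> n * p" using that by (intro mult_le_mono1) simp
    finally show ?thesis .
  qed
  have "(kronecker_mat A B * kronecker_mat C D) $$ (i, j)
      = (\<Sum>a<n. \<Sum>b<p. (A $$ (i div p, a) * B $$ (i mod p, b)) * (C $$ (a, j div p) * D $$ (b, j mod p)))"
    unfolding mult_mat_entry[OF K i j] sum_lessThan_mult
    by (intro sum.cong refl) (simp add: kronecker_mat_entry[OF A B i] kronecker_mat_entry[OF C D _ j] lt)
  also have "\<dots> = (\<Sum>a<n. A $$ (i div p, a) * C $$ (a, j div p)) * (\<Sum>b<p. B $$ (i mod p, b) * D $$ (b, j mod p))"
    by (simp add: sum_product ac_simps)
  also have "\<dots> = kronecker_mat (A * C) (B * D) $$ (i, j)"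
    by (simp add: kronecker_mat_entry[OF AC BD i j] mult_mat_entry[OF A C] mult_mat_entry[OF B D] bounds)
  finally show "(kronecker_mat A B * kronecker_mat C D) $$ (i, j) = kronecker_mat (A * C) (B * D) $$ (i, j)" .
qed (use A B C D in \<open>simp_all add: kronecker_mat_def\<close>)

lemma kronecker_mat_one: "kronecker_mat (1\<^sub>m n) (1\<^sub>m p) = (1\<^sub>m (n * p) :: 'a::field mat)"
proof (rule eq_matI)
  fix i j assume "i < dim_row (1\<^sub>m (n * p) :: 'a mat)" "j < dim_col (1\<^sub>m (n * p) :: 'a mat)"
  then have i: "i < n * p" and j: "j < n * p" by auto
  have p: "0 < p" using i by (cases p) auto
  have "i = j \<longleftrightarrow> i div p = j div p \<and> i mod p = j mod p" by (metis div_mult_mod_eq)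
  then show "kronecker_mat (1\<^sub>m n) (1\<^sub>m p) $$ (i, j) = (1\<^sub>m (n * p) :: 'a mat) $$ (i, j)"
    using i j p by (auto simp: kronecker_mat_def less_mult_imp_div_less)
qed (simp_all add: kronecker_mat_def)

lemma kronecker_mat_pow:
  assumes A: "A \<in> carrier_mat n n" and B: "B \<in> carrier_mat p p"
  shows "kronecker_mat A B ^\<^sub>m k = kronecker_mat (A ^\<^sub>m k) (B ^\<^sub>m k)"
proof (induction k)
  case 0
  then show ?case using kronecker_mat_carrier[OF A B] A B by (simp add: kronecker_mat_one)
next
  case (Suc k)
  then show ?case
    using kronecker_mat_mult[OF pow_carrier_mat[OF A] pow_carrier_mat[OF B] A B] by simp
qed

lemma kronecker_mat_pow_first_column:
  assumes A: "commutant_cyclic n A" and B: "commutant_cyclic p B" and "i < n * p"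
  shows "(kronecker_mat A B ^\<^sub>m k) $$ (i, 0) = (A ^\<^sub>m k) $$ (i div p, 0) * (B ^\<^sub>m k) $$ (i mod p, 0)"
proof -
  have c: "A \<in> carrier_mat n n" "B \<in> carrier_mat p p" "0 < n * p"
    using A B by (auto simp: commutant_cyclic_def)
  show ?thesis
    using kronecker_mat_entry[OF pow_carrier_mat[OF c(1)] pow_carrier_mat[OF c(2)] assms(3) c(3)]
    by (simp add: kronecker_mat_pow[OF c(1,2)])
qed

text \<open>If \<open>U\<close> and \<open>V\<close> commute with \<open>A\<close> and \<open>B\<close>, then \<open>U \<otimes> V\<close> commutes with \<open>A \<otimes> B\<close>, and it takes
  \<open>e_0 \<otimes> e_0\<close> to \<open>U e_0 \<otimes> V e_0\<close>.\<close>

lemma commutant_cyclic_kronecker_mat: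
  assumes cA: "commutant_cyclic n A" and cB: "commutant_cyclic p B"
  shows "commutant_cyclic (n * p) (kronecker_mat A B)"
  unfolding commutant_cyclic_def
proof (intro conjI allI impI)
  have A: "A \<in> carrier_mat n n" and n: "0 < n" and B: "B \<in> carrier_mat p p" and p: "0 < p"
    using cA cB by (auto simp: commutant_cyclic_def)
  show "kronecker_mat A B \<in> carrier_mat (n * p) (n * p)" by (rule kronecker_mat_carrier[OF A B])
  show np: "0 < n * p" using n p by simp
  fix j assume j: "j < n * p"
  have bounds: "j div p < n" "j mod p < p" using j p by (auto simp: less_mult_imp_div_less)
  obtain U where U: "U \<in> carrier_mat n n" "A * U = U * A"
      "\<And>i. i < n \<Longrightarrow> U $$ (i, 0) = (if i = j div p then 1 else 0)"
    using cA bounds(1) unfolding commutant_cyclic_def by blast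
  obtain V where V: "V \<in> carrier_mat p p" "B * V = V * B"
      "\<And>i. i < p \<Longrightarrow> V $$ (i, 0) = (if i = j mod p then 1 else 0)"
    using cB bounds(2) unfolding commutant_cyclic_def by blast
  have "kronecker_mat A B * kronecker_mat U V = kronecker_mat U V * kronecker_mat A B"
    by (simp add: kronecker_mat_mult[OF A B U(1) V(1)] kronecker_mat_mult[OF U(1) V(1) A B] U(2) V(2))
  moreover have "kronecker_mat U V $$ (i, 0) = (if i = j then 1 else 0)" if i: "i < n * p" for i
  proof -
    have "i = j \<longleftrightarrow> i div p = j div p \<and> i mod p = j mod p" by (metis div_mult_mod_eq)
    moreover have "i div p < n" "i mod p < p" using i p by (auto simp: less_mult_imp_div_less)
    ultimately show ?thesis
      by (simp add: kronecker_mat_entry[OF U(1) V(1) i np] U(3) V(3))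
  qed
  ultimately show "\<exists>W\<in>carrier_mat (n * p) (n * p).
      kronecker_mat A B * W = W * kronecker_mat A B \<and> (\<forall>i<n * p. W $$ (i, 0) = (if i = j then 1 else 0))"
    using kronecker_mat_carrier[OF U(1) V(1)] by blast
qed

section \<open>Products of spaces of sequences\<close>

lemma subspace_orbit_space: "seq.subspace (orbit_space A)"
proof (rule seq.subspaceI)
  show "0 \<in> orbit_space A"
    by (auto simp: orbit_space_def fun_eq_iff intro!: exI[of _ "\<lambda>_. 0"])
next
  fix u v assume "u \<in> orbit_space A" "v \<in> orbit_space A"
  then obtain w w' where "u = (\<lambda>k. \<Sum>i<dim_row A. w i * (A ^\<^sub>m k) $$ (i, 0))"
      "v = (\<lambda>k. \<Sum>i<dim_row A. w' i * (A ^\<^sub>m k) $$ (i, 0))"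
    by (auto simp: orbit_space_def)
  then show "u + v \<in> orbit_space A"
    by (auto simp: orbit_space_def fun_eq_iff sum.distrib ring_distribs intro!: exI[of _ "\<lambda>i. w i + w' i"])
next
  fix c u assume "u \<in> orbit_space A"
  then obtain w where "u = (\<lambda>k. \<Sum>i<dim_row A. w i * (A ^\<^sub>m k) $$ (i, 0))"
    by (auto simp: orbit_space_def)
  then show "seq_scale c u \<in> orbit_space A"
    by (auto simp: orbit_space_def fun_eq_iff seq_scale_def sum_distrib_left mult.assoc
        intro!: exI[of _ "\<lambda>i. c * w i"])
qed

lemma orbit_space_entry:
  assumes "i < dim_row A"
  shows "(\<lambda>k. (A ^\<^sub>m k) $$ (i, 0)) \<in> orbit_space A"
proof -
  let ?w = "\<lambda>l. if l = i then 1 else 0"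
  have "(\<lambda>k. (A ^\<^sub>m k) $$ (i, 0)) = (\<lambda>k. \<Sum>l<dim_row A. ?w l * (A ^\<^sub>m k) $$ (l, 0))"
    using assms by (simp add: if_distrib[of "\<lambda>t. t * _"] cong: if_cong)
  then show ?thesis unfolding orbit_space_def by (intro CollectI exI[of _ ?w] conjI TrueI)
qed

text \<open>Row vectors \<open>w\<close> and \<open>w'\<close> for the factors give \<open>w \<otimes> w'\<close> for the product.\<close>

lemma orbit_space_kronecker_mult:
  assumes cA: "commutant_cyclic n A" and cB: "commutant_cyclic p B"
    and u: "u \<in> orbit_space A" and v: "v \<in> orbit_space B"
  shows "(\<lambda>k. u k * v k) \<in> orbit_space (kronecker_mat A B)"
proof -
  have A: "A \<in> carrier_mat n n" and B: "B \<in> carrier_mat p p" and p: "0 < p"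
    using cA cB by (auto simp: commutant_cyclic_def)
  obtain w w' where u: "u = (\<lambda>k. \<Sum>a<n. w a * (A ^\<^sub>m k) $$ (a, 0))"
      and v: "v = (\<lambda>k. \<Sum>b<p. w' b * (B ^\<^sub>m k) $$ (b, 0))"
    using u v A B by (auto simp: orbit_space_def)
  have "u k * v k = (\<Sum>i<n * p. (w (i div p) * w' (i mod p)) * (kronecker_mat A B ^\<^sub>m k) $$ (i, 0))" for k
  proof -
    have "(\<Sum>i<n * p. (w (i div p) * w' (i mod p)) * (kronecker_mat A B ^\<^sub>m k) $$ (i, 0))
        = (\<Sum>i<n * p. (w (i div p) * w' (i mod p)) * ((A ^\<^sub>m k) $$ (i div p, 0) * (B ^\<^sub>m k) $$ (i mod p, 0)))"
      by (intro sum.cong refl) (simp add: kronecker_mat_pow_first_column[OF cA cB])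
    also have "\<dots> = (\<Sum>a<n. \<Sum>b<p. (w a * (A ^\<^sub>m k) $$ (a, 0)) * (w' b * (B ^\<^sub>m k) $$ (b, 0)))"
      unfolding sum_lessThan_mult by (intro sum.cong refl) (simp add: ac_simps)
    finally show ?thesis by (simp add: u v sum_product)
  qed
  then show ?thesis using A B unfolding orbit_space_def by (auto simp: kronecker_mat_def)
qed

text \<open>One inclusion is the preceding multiplication rule. For the other, the sequence of a row vector
  \<open>w\<close> is the combination, with coefficients \<open>w_l\<close>, of products of an entry sequence of \<open>A^k e_0\<close>
  and one of \<open>B^k e_0\<close>; the second factor is only a combination of termwise products, which is why
  products with an arbitrary member of the span are treated first (\<open>mult\<close>).\<close>

lemma seq_space_prod_insert:
  assumes cA: "commutant_cyclic n A" and cB: "commutant_cyclic p B"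
    and "finite I" "i \<notin> I" and Si: "S i = orbit_space A" and SI: "seq_space_prod I S = orbit_space B"
  shows "seq_space_prod (insert i I) S = orbit_space (kronecker_mat A B)"
proof
  have A: "A \<in> carrier_mat n n" and B: "B \<in> carrier_mat p p" and p: "0 < p"
    using cA cB by (auto simp: commutant_cyclic_def)
  show "seq_space_prod (insert i I) S \<subseteq> orbit_space (kronecker_mat A B)"
    unfolding seq_space_prod_def
  proof (rule seq.span_minimal[OF _ subspace_orbit_space], safe)
    fix u assume u: "\<forall>j\<in>insert i I. u j \<in> S j"
    then have "(\<lambda>k. \<Prod>j\<in>I. u j k) \<in> orbit_space B"
      unfolding SI[symmetric] seq_space_prod_def by (intro seq.span_base) auto
    then show "(\<lambda>k. \<Prod>j\<in>insert i I. u j k) \<in> orbit_space (kronecker_mat A B)"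
      using u assms(3,4) orbit_space_kronecker_mult[OF cA cB, of "u i"] Si by simp
  qed
  have mult: "(\<lambda>k. u k * v k) \<in> seq_space_prod (insert i I) S"
    if u: "u \<in> S i" and v: "v \<in> seq_space_prod I S" for u v
    using v unfolding seq_space_prod_def
  proof (induction rule: seq.span_induct_alt)
    case base
    have zero: "(\<lambda>k. u k * 0 k) = 0" by (simp add: fun_eq_iff)
    show ?case unfolding zero by (rule seq.span_zero)
  next
    case (step c x y)
    then obtain t where t: "x = (\<lambda>k. \<Prod>j\<in>I. t j k)" "\<forall>j\<in>I. t j \<in> S j" by auto
    have "(\<lambda>k. u k * x k) = (\<lambda>k. \<Prod>j\<in>insert i I. (t(i := u)) j k)"
    proof
      fix k
      have "(\<Prod>j\<in>I. (t(i := u)) j k) = (\<Prod>j\<in>I. t j k)"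
        using assms(4) by (intro prod.cong) auto
      then show "u k * x k = (\<Prod>j\<in>insert i I. (t(i := u)) j k)"
        using assms(3,4) t(1) by simp
    qed
    moreover have "\<forall>j\<in>insert i I. (t(i := u)) j \<in> S j" using t(2) u by auto
    ultimately have ux: "(\<lambda>k. u k * x k) \<in> seq.span {\<lambda>k. \<Prod>j\<in>insert i I. u j k |u. \<forall>j\<in>insert i I. u j \<in> S j}"
      by (intro seq.span_base) blast
    have split: "(\<lambda>k. u k * (seq_scale c x + y) k) = seq_scale c (\<lambda>k. u k * x k) + (\<lambda>k. u k * y k)"
      by (simp add: fun_eq_iff seq_scale_def algebra_simps)
    show ?case unfolding split by (rule seq.span_add[OF seq.span_scale[OF ux] step.IH])
  qed
  show "orbit_space (kronecker_mat A B) \<subseteq> seq_space_prod (insert i I) S"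
  proof
    fix z assume "z \<in> orbit_space (kronecker_mat A B)"
    then obtain w where z: "z = (\<lambda>k. \<Sum>l<n * p. w l * (kronecker_mat A B ^\<^sub>m k) $$ (l, 0))"
      using A B by (auto simp: orbit_space_def kronecker_mat_def)
    have "z = (\<Sum>l<n * p. seq_scale (w l) (\<lambda>k. (A ^\<^sub>m k) $$ (l div p, 0) * (B ^\<^sub>m k) $$ (l mod p, 0)))"
      by (rule ext) (simp add: z sum_fun_apply seq_scale_def kronecker_mat_pow_first_column[OF cA cB])
    also have "\<dots> \<in> seq.span (seq_space_prod (insert i I) S)"
    proof (intro seq.span_sum seq.span_scale seq.span_base mult)
      fix l assume "l \<in> {..<n * p}"
      then have "l div p < n" "l mod p < p" using p by (auto simp: less_mult_imp_div_less)
      then show "(\<lambda>k. (A ^\<^sub>m k) $$ (l div p, 0)) \<in> S i"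
          "(\<lambda>k. (B ^\<^sub>m k) $$ (l mod p, 0)) \<in> seq_space_prod I S"
        unfolding Si SI using A B by (auto intro!: orbit_space_entry)
    qed
    finally show "z \<in> seq_space_prod (insert i I) S" by (simp add: seq_space_prod_def seq.span_span)
  qed
qed

lemma commutant_cyclic_one: "commutant_cyclic 1 (1\<^sub>m 1)"
  unfolding commutant_cyclic_def by (auto intro!: bexI[of _ "1\<^sub>m 1"])

lemma orbit_space_one: "orbit_space (1\<^sub>m 1 :: 'a::field mat) = {\<lambda>_. c | c. True}"
proof -
  have "(1\<^sub>m 1 :: 'a mat) ^\<^sub>m k = 1\<^sub>m 1" for k by (induction k) auto
  then show ?thesis by (auto simp: orbit_space_def)
qed

lemma seq_space_prod_empty: "seq_space_prod {} S = orbit_space (1\<^sub>m 1 :: 'a::field mat)"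
proof -
  have "{\<lambda>k. \<Prod>i\<in>{}. u i k | u. \<forall>i\<in>{}. u i \<in> S i} = {\<lambda>_. 1}" by simp
  then show ?thesis
    unfolding seq_space_prod_def orbit_space_one by (auto simp: seq.span_singleton seq_scale_def)
qed

lemma seq_space_prod_eq_orbit_space_kronecker_list:
  assumes "distinct xs" "\<And>i. i \<in> set xs \<Longrightarrow> degree (P i) > 0"
  shows "(\<exists>n. commutant_cyclic n (kronecker_list (map (\<lambda>i. companion_mat (P i)) xs))) \<and>
    seq_space_prod (set xs) (\<lambda>i. lin_rec_space (P i))
      = orbit_space (kronecker_list (map (\<lambda>i. companion_mat (P i)) xs))"
  using assms
proof (induction xs)
  case Nil
  then show ?case using commutant_cyclic_one
    by (auto simp: kronecker_list_def seq_space_prod_empty)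
next
  case (Cons i xs)
  let ?B = "kronecker_list (map (\<lambda>i. companion_mat (P i)) xs)"
  have K: "kronecker_list (map (\<lambda>i. companion_mat (P i)) (i # xs)) = kronecker_mat (companion_mat (P i)) ?B"
    by (simp add: kronecker_list_def)
  obtain p where p: "commutant_cyclic p ?B"
    and S: "seq_space_prod (set xs) (\<lambda>i. lin_rec_space (P i)) = orbit_space ?B"
    using Cons by auto
  have d: "degree (P i) > 0" using Cons.prems by simp
  note cA = commutant_cyclic_companion_mat[OF d]
  show ?case
    using commutant_cyclic_kronecker_mat[OF cA p]
      seq_space_prod_insert[OF cA p, of "set xs" i "\<lambda>i. lin_rec_space (P i)"]
      lin_rec_space_eq_orbit_space[OF d] S Cons.prems(1)
    unfolding K by auto
qed

theorem theorem2p8: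
  fixes P :: "nat \<Rightarrow> 'a::field poly" and m :: nat
  assumes "m \<ge> 1"
    and "\<And>i. i < m \<Longrightarrow> lead_coeff (P i) = 1"
    and "\<And>i. i < m \<Longrightarrow> degree (P i) > 0"
  shows "seq_space_prod {..<m} (\<lambda>i. lin_rec_space (P i)) =
         lin_rec_space (min_poly_mat (kronecker_list (map (\<lambda>i. companion_mat (P i)) [0..<m])))"
proof -
  let ?K = "kronecker_list (map (\<lambda>i. companion_mat (P i)) [0..<m])"
  have "set [0..<m] = {..<m}" by auto
  then obtain n where cyc: "commutant_cyclic n ?K"
    and prod: "seq_space_prod {..<m} (\<lambda>i. lin_rec_space (P i)) = orbit_space ?K"
    using seq_space_prod_eq_orbit_space_kronecker_list[of "[0..<m]" P] assms(3) by auto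
  show ?thesis unfolding prod by (rule orbit_space_eq_lin_rec_space[OF cyc])
qed

end
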